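(* Let $M$ be the McLain group of a non-empty totally ordered set $(\Lambda,\leq)$ over a ring $R$ with $1\neq0$, let $F$ be a field such that $R$ admits a right primitive linear character $R^+\to F^*$, let $D=\{(\alpha_1,\beta_1),\dots,(\alpha_m,\beta_m)\}$ be a basic subset of $\Phi$, and let $I\leq M$ be the subgroup associated to $D$ as in the context. Let $\alpha=\min\{\alpha_i:1\le i\le m\}$ and $\beta=\max\{\beta_i:1\le i\le m\}$. Suppose the closed interval $[\alpha,\beta]$ of $\Lambda$ is well-ordered under $\geq$, the inverse order of $\leq$. Assume, in addition, that $R$ is finite. Then $I$ is a strongly ascendant subgroup of $M$ (relative to $\mathrm{char}(F)$).
   Context: McLain group: $\Phi=\{(\alpha,\beta)\in\Lambda\times\Lambda:\alpha<\beta\}$. $J$ is the free left $R$-module with basis $e_{\alpha\beta}$, $(\alpha,\beta)\in\Phi$ ($R$ not necessarily commutative), made into a ring by $(re_{\alpha\beta})(se_{\beta\gamma})=rs\,e_{\alpha\gamma}$ and $(re_{\alpha\beta})(se_{\gamma\delta})=0$ if $\beta\neq\gamma$, extended additively. $J$ is nil, and $M=\{1+x:x\in J\}$ is a group under multiplication. $M_{\alpha\beta}=\{1+re_{\alpha\beta}:r\in R\}$. A subset $\Delta\subseteq\Phi$ is closed if $(\alpha,\beta),(\beta,\gamma)\in\Delta$ implies $(\alpha,\gamma)\in\Delta$; then $M(\Delta)=\langle M_{\alpha\beta}:(\alpha,\beta)\in\Delta\rangle$. A group homomorphism $R^+\to F^*$ is right primitive if the only right ideal of $R$ contained in its kernel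 is $(0)$. A finite non-empty subset $D=\{(\alpha_1,\beta_1),\dots,(\alpha_m,\beta_m)\}$ of $\Phi$ is basic if the $\alpha_i$ are distinct and the $\beta_i$ are distinct. Notation attached to $D$: $\Gamma=\Phi\setminus\bigcup_i\{(\alpha_i,\gamma)\in\Phi:\gamma<\beta_i\}$, $\Omega=\{(\alpha,\gamma)\in\Phi:\exists\,(\alpha,\beta),(\gamma,\delta)\in D\text{ with }\alpha<\gamma<\beta<\delta\}$, $\Gamma_1=\Gamma\cup\Omega$ (a closed subset of $\Phi$), $I=M(\Gamma_1)$. A subgroup $S$ of a group $T$ is strongly ascendant (relative to $\mathrm{char}(F)$) if there is a well-ordered set $(X,\leq)$ with first element $x_0$ and last element $x_1$, and subgroups $S_x$, $x\in X$, of $T$ such that: $S_{x_0}=S$; $S_{x_1}=T$; for every $x\in X$, $x\neq x_1$, with successor $x'\in X$, $S_x$ is normal of finite index in $S_{x'}$ with $\mathrm{char}(F)\nmid[S_{x'}:S_x]$ (vacuous in characteristic $0$); and if $x\in X$, $x\neq x_0$, has no immediate predecessor in $X$, then $S_x=\bigcup_{y<x}S_y$. *)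

theory Defs
  imports
    "HOL-Algebra.Generated_Groups"
    "HOL-Computational_Algebra.Computational_Algebra"
    "HOL-Library.Groups_Big_Fun"
begin

section \<open>The McLain group\<close>

text \<open>
  The free left module \<open>J\<close> on the symbols \<open>e\<^sub>\<alpha>\<^sub>\<beta>\<close> is the set of finitely supported functions on
  \<open>\<Phi>\<close>, written as \<open>\<Lambda> \<times> \<Lambda>\<close> matrices; under this identification its product is the matrix product
  (see \<open>mmult_unit\<close> below). Matrices also provide the unital ring in which \<open>1 + x\<close> lives.
\<close>

type_synonym ('a, 'r) mat = "'a \<Rightarrow> 'a \<Rightarrow> 'r"

definition Phi :: "('a::linorder \<times> 'a) set" where
  "Phi = {(\<alpha>, \<beta>). \<alpha> < \<beta>}"

definition J :: "('a::linorder, 'r::ring_1) mat set" where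
  "J = {x. finite {(\<alpha>, \<beta>). x \<alpha> \<beta> \<noteq> 0} \<and> {(\<alpha>, \<beta>). x \<alpha> \<beta> \<noteq> 0} \<subseteq> Phi}"

text \<open>\<open>r e\<^sub>\<alpha>\<^sub>\<beta>\<close>\<close>
definition unit_mat :: "'r::ring_1 \<Rightarrow> 'a \<Rightarrow> 'a \<Rightarrow> ('a, 'r) mat" where
  "unit_mat r \<alpha> \<beta> = (\<lambda>a b. if a = \<alpha> \<and> b = \<beta> then r else 0)"

text \<open>For the row-finite matrices used here only finitely many summands are nonzero.\<close>
definition mmult :: "('a, 'r::ring_1) mat \<Rightarrow> ('a, 'r) mat \<Rightarrow> ('a, 'r) mat" where
  "mmult A B = (\<lambda>a c. Sum_any (\<lambda>b. A a b * B b c))"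

definition madd :: "('a, 'r::ring_1) mat \<Rightarrow> ('a, 'r) mat \<Rightarrow> ('a, 'r) mat" where
  "madd A B = (\<lambda>a b. A a b + B a b)"

definition mone :: "('a, 'r::ring_1) mat" where
  "mone = (\<lambda>a b. if a = b then 1 else 0)"

definition McLain :: "('a::linorder, 'r::ring_1) mat monoid" where
  "McLain = \<lparr>carrier = {madd mone x | x. x \<in> J}, monoid.mult = mmult, one = mone\<rparr>"

definition root_subgroup :: "'a \<Rightarrow> 'a \<Rightarrow> ('a::linorder, 'r::ring_1) mat set" where
  "root_subgroup \<alpha> \<beta> = {madd mone (unit_mat r \<alpha> \<beta>) | r. True}"

definition closed_rel :: "('a::linorder \<times> 'a) set \<Rightarrow> bool" where
  "closed_rel \<Delta> \<longleftrightarrow> \<Delta> \<subseteq> Phi \<and>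
     (\<forall>\<alpha> \<beta> \<gamma>. (\<alpha>, \<beta>) \<in> \<Delta> \<and> (\<beta>, \<gamma>) \<in> \<Delta> \<longrightarrow> (\<alpha>, \<gamma>) \<in> \<Delta>)"

text \<open>Meant for closed \<open>\<Delta>\<close>; that \<open>\<Gamma>\<^sub>1\<close> is closed is \<open>closed_Gamma1\<close> below.\<close>
definition M_of :: "('a::linorder \<times> 'a) set \<Rightarrow> ('a, 'r::ring_1) mat set" where
  "M_of \<Delta> = generate McLain (\<Union>(\<alpha>, \<beta>) \<in> \<Delta>. root_subgroup \<alpha> \<beta>)"


section \<open>Primitive characters\<close>

definition right_ideal :: "'r::ring_1 set \<Rightarrow> bool" where
  "right_ideal K \<longleftrightarrow> 0 \<in> K \<and> (\<forall>a\<in>K. \<forall>b\<in>K. a - b \<in> K) \<and> (\<forall>a\<in>K. \<forall>r. a * r \<in> K)"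

definition linear_character :: "('r::ring_1 \<Rightarrow> 'f::field) \<Rightarrow> bool" where
  "linear_character \<chi> \<longleftrightarrow> (\<forall>a. \<chi> a \<noteq> 0) \<and> (\<forall>a b. \<chi> (a + b) = \<chi> a * \<chi> b)"

definition right_primitive :: "('r::ring_1 \<Rightarrow> 'f::field) \<Rightarrow> bool" where
  "right_primitive \<chi> \<longleftrightarrow> linear_character \<chi> \<and>
     (\<forall>K. right_ideal K \<and> K \<subseteq> {a. \<chi> a = 1} \<longrightarrow> K = {0})"


section \<open>Basic subsets\<close>

definition basic_subset :: "('a::linorder \<times> 'a) set \<Rightarrow> bool" where
  "basic_subset D \<longleftrightarrow> finite D \<and> D \<noteq> {} \<and> D \<subseteq> Phi \<and> inj_on fst D \<and> inj_on snd D"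

definition Gamma :: "('a::linorder \<times> 'a) set \<Rightarrow> ('a \<times> 'a) set" where
  "Gamma D = Phi - (\<Union>(\<alpha>, \<beta>) \<in> D. {(\<alpha>, \<gamma>) | \<gamma>. (\<alpha>, \<gamma>) \<in> Phi \<and> \<gamma> < \<beta>})"

definition Omega :: "('a::linorder \<times> 'a) set \<Rightarrow> ('a \<times> 'a) set" where
  "Omega D = {(\<alpha>, \<gamma>). (\<alpha>, \<gamma>) \<in> Phi \<and>
     (\<exists>\<beta> \<delta>. (\<alpha>, \<beta>) \<in> D \<and> (\<gamma>, \<delta>) \<in> D \<and> \<alpha> < \<gamma> \<and> \<gamma> < \<beta> \<and> \<beta> < \<delta>)}"

definition Gamma1 :: "('a::linorder \<times> 'a) set \<Rightarrow> ('a \<times> 'a) set" where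
  "Gamma1 D = Gamma D \<union> Omega D"

definition I_of :: "('a::linorder \<times> 'a) set \<Rightarrow> ('a, 'r::ring_1) mat set" where
  "I_of D = M_of (Gamma1 D)"


section \<open>Strongly ascendant subgroups\<close>

definition successor :: "'i rel \<Rightarrow> 'i \<Rightarrow> 'i \<Rightarrow> bool" where
  "successor r x x' \<longleftrightarrow> (x, x') \<in> r \<and> x \<noteq> x' \<and> (\<forall>y. (x, y) \<in> r \<and> (y, x') \<in> r \<longrightarrow> y = x \<or> y = x')"

text \<open>
  The well-ordered set \<open>X\<close> is \<open>Field r\<close>. If \<open>p = 0\<close> the divisibility condition holds automatically,
  since the index is finite and hence nonzero.
\<close>
definition strongly_ascending_series ::
    "nat \<Rightarrow> ('g, 'b) monoid_scheme \<Rightarrow> 'g set \<Rightarrow> 'i rel \<Rightarrow> ('i \<Rightarrow> 'g set) \<Rightarrow> bool" where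
  "strongly_ascending_series p T S r f \<longleftrightarrow> Well_order r \<and>
    (\<exists>x0\<in>Field r. \<exists>x1\<in>Field r.
      (\<forall>x\<in>Field r. (x0, x) \<in> r \<and> (x, x1) \<in> r) \<and>
      f x0 = S \<and> f x1 = carrier T \<and>
      (\<forall>x\<in>Field r. subgroup (f x) T) \<and>
      (\<forall>x x'. successor r x x' \<longrightarrow>
         f x \<lhd> T\<lparr>carrier := f x'\<rparr> \<and>
         finite (rcosets\<^bsub>T\<lparr>carrier := f x'\<rparr>\<^esub> (f x)) \<and>
         \<not> p dvd card (rcosets\<^bsub>T\<lparr>carrier := f x'\<rparr>\<^esub> (f x))) \<and>
      (\<forall>x\<in>Field r. x \<noteq> x0 \<and> (\<nexists>y. successor r y x) \<longrightarrow>
         f x = (\<Union>y\<in>{y. (y, x) \<in> r \<and> y \<noteq> x}. f y)))"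

text \<open>
  The existential over well-ordered sets has to name a type. Indices of type \<open>'g set\<close> lose nothing:
  see \<open>strongly_ascendantI\<close>, which accepts a series indexed by an arbitrary type.
\<close>
definition strongly_ascendant :: "nat \<Rightarrow> 'g set \<Rightarrow> ('g, 'b) monoid_scheme \<Rightarrow> bool" where
  "strongly_ascendant p S T \<longleftrightarrow>
     (\<exists>(r :: 'g set rel) f. strongly_ascending_series p T S r f)"

lemma strongly_ascendantI:
  fixes r :: "'i rel" and f :: "'i \<Rightarrow> 'g set"
  assumes "strongly_ascending_series p T S r f"
  shows "strongly_ascendant p S T"
proof -
  define X where "X = Field r"
  obtain x0 x1 where wo: "well_order_on X r" and x0: "x0 \<in> X" and x1: "x1 \<in> X"
    and bnd': "\<forall>x\<in>X. (x0, x) \<in> r \<and> (x, x1) \<in> r"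
    and f0: "f x0 = S" and f1: "f x1 = carrier T"
    and sub': "\<forall>x\<in>X. subgroup (f x) T"
    and succ0: "\<forall>x x'. successor r x x' \<longrightarrow>
         f x \<lhd> T\<lparr>carrier := f x'\<rparr> \<and>
         finite (rcosets\<^bsub>T\<lparr>carrier := f x'\<rparr>\<^esub> (f x)) \<and>
         \<not> p dvd card (rcosets\<^bsub>T\<lparr>carrier := f x'\<rparr>\<^esub> (f x))"
    and lim0: "\<forall>x\<in>X. x \<noteq> x0 \<and> (\<nexists>y. successor r y x) \<longrightarrow>
         f x = (\<Union>y\<in>{y. (y, x) \<in> r \<and> y \<noteq> x}. f y)"
    using assms unfolding strongly_ascending_series_def X_def[symmetric]
    by (elim conjE bexE) (rule that, assumption+)
  note bnd = bspec[OF bnd'] and sub = bspec[OF sub'] and succ = succ0[rule_format]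
  have lim: "f x = (\<Union>y\<in>{y. (y, x) \<in> r \<and> y \<noteq> x}. f y)"
    if "x \<in> X" "x \<noteq> x0" "\<nexists>y. successor r y x" for x
    using bspec[OF lim0 that(1)] that(2,3) by (rule mp[OF _ conjI])
  have tr: "(x, z) \<in> r" if "(x, y) \<in> r" "(y, z) \<in> r" for x y z
    using wo that unfolding order_on_defs trans_def by blast
  have anti: "x = y" if "(x, y) \<in> r" "(y, x) \<in> r" for x y
    using wo that unfolding order_on_defs antisym_def by blast
  have tot: "(x, y) \<in> r \<or> (y, x) \<in> r" if "x \<in> X" "y \<in> X" for x y
    using wo that unfolding order_on_defs total_on_def refl_on_def by metis
  have rX: "x \<in> X" "y \<in> X" if "(x, y) \<in> r" for x y
    using that unfolding X_def Field_def by blast+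
  have wf: "wf (r - Id)" using wo unfolding well_order_on_def by blast
  have least: "\<exists>x\<in>Q. \<forall>y\<in>Q. (x, y) \<in> r" if "Q \<subseteq> X" "Q \<noteq> {}" for Q
  proof -
    obtain x where "x \<in> Q" "\<And>y. (y, x) \<in> r - Id \<Longrightarrow> y \<notin> Q"
      using wf \<open>Q \<noteq> {}\<close> unfolding wf_eq_minimal by blast
    moreover have "(x, y) \<in> r" if "y \<in> Q" for y
      using calculation that tot[of x y] \<open>Q \<subseteq> X\<close> by (cases "x = y") auto
    ultimately show ?thesis by blast
  qed
  have mono: "(x, y) \<in> r \<Longrightarrow> f x \<subseteq> f y" for x y
  proof (induction y rule: wf_induct_rule[OF wf])
    case (1 y)
    show ?case
    proof (cases "x = y")
      case False
      have "y \<noteq> x0" using False 1(2) bnd rX anti by blast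
      show ?thesis
      proof (cases "\<exists>z. successor r z y")
        case True
        then obtain z where z: "successor r z y" by blast
        have "(x, z) \<in> r" using z tot[of x z] rX 1(2) False
          unfolding successor_def by blast
        then have "f x \<subseteq> f z" using 1(1) z unfolding successor_def by blast
        moreover have "f z \<subseteq> f y"
          using succ[OF z] normal_imp_subgroup subgroup.subset by fastforce
        ultimately show ?thesis by blast
      next
        case no: False
        show ?thesis using lim[OF _ \<open>y \<noteq> x0\<close> no] 1(2) False rX by blast
      qed
    qed auto
  qed
  define r' where "r' = {(A, B). A \<in> f ` X \<and> B \<in> f ` X \<and> A \<subseteq> B}"
  have field: "Field r' = f ` X" unfolding r'_def Field_def by auto
  have cmp: "A \<subseteq> B \<or> B \<subseteq> A" if "A \<in> f ` X" "B \<in> f ` X" for A B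
    using that tot mono by blast
  have "wf (r' - Id)"
  proof (rule wfI_min)
    fix A Q assume "A \<in> (Q :: 'g set set)"
    show "\<exists>z\<in>Q. \<forall>y. (y, z) \<in> r' - Id \<longrightarrow> y \<notin> Q"
    proof (cases "Q \<inter> f ` X = {}")
      case True
      then have "\<forall>y. (y, A) \<in> r' - Id \<longrightarrow> y \<notin> Q" unfolding r'_def by auto
      then show ?thesis using \<open>A \<in> Q\<close> by blast
    next
      case False
      then have "{x\<in>X. f x \<in> Q} \<noteq> {}" by auto
      with least[of "{x\<in>X. f x \<in> Q}"] obtain x
        where x: "f x \<in> Q" and xmin: "\<And>y. y \<in> X \<Longrightarrow> f y \<in> Q \<Longrightarrow> (x, y) \<in> r"
        by auto
      have "B \<notin> Q" if B: "(B, f x) \<in> r' - Id" for B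
      proof
        assume "B \<in> Q"
        obtain b where "b \<in> X" "B = f b" using B unfolding r'_def by auto
        then have "f x \<subseteq> B" using xmin[of b] mono \<open>B \<in> Q\<close> by auto
        then show False using B unfolding r'_def by auto
      qed
      with x show ?thesis by auto
    qed
  qed
  then have wo': "Well_order r'"
    unfolding order_on_defs field refl_on_def trans_def antisym_def total_on_def
    using cmp by (auto simp: r'_def)
  have succ': "\<exists>x x'. successor r x x' \<and> f x = A \<and> f x' = B" if "successor r' A B" for A B
  proof -
    have AB: "A \<in> f ` X" "B \<in> f ` X" "A \<subset> B"
      using that unfolding successor_def r'_def by auto
    then obtain b where "b \<in> X" "f b = B" by blast
    then obtain y where y: "y \<in> X" "\<not> f y \<subseteq> A" and ymin: "\<forall>z\<in>{z\<in>X. \<not> f z \<subseteq> A}. (y, z) \<in> r"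
      using least[of "{z\<in>X. \<not> f z \<subseteq> A}"] AB(3) by blast
    have below: "f z \<subseteq> A" if "(z, y) \<in> r" "z \<noteq> y" for z
      using that ymin anti rX by blast
    have "f y \<subseteq> B" using mono ymin \<open>b \<in> X\<close> \<open>f b = B\<close> AB(3) by blast
    moreover have "A \<subseteq> f y" using cmp y AB(1) by blast
    ultimately have fy: "f y = B"
      using that y AB(1,2) unfolding successor_def r'_def by blast
    obtain a where a: "a \<in> X" "f a = A" using AB(1) by blast
    have ay: "(a, y) \<in> r" "a \<noteq> y" using tot[of a y] a y mono by blast+
    have "y \<noteq> x0" using ay bnd anti a by blast
    then obtain z where z: "successor r z y"
      using lim[OF y(1)] below y(2) by blast
    have "(a, z) \<in> r" using z tot[of a z] rX ay a unfolding successor_def by blast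
    then have "A \<subseteq> f z" using mono a by blast
    moreover have "f z \<subseteq> A" using below z unfolding successor_def by blast
    ultimately show ?thesis using z fy by blast
  qed
  have lim': "A = \<Union>{B. (B, A) \<in> r' \<and> B \<noteq> A}"
    if A: "A \<in> f ` X" "A \<noteq> f x0" "\<nexists>B. successor r' B A" for A
  proof -
    obtain y where y: "y \<in> X" "f y = A" and ymin: "\<forall>z\<in>{z\<in>X. f z = A}. (y, z) \<in> r"
      using least[of "{z\<in>X. f z = A}"] A(1) by blast
    have ne: "f z \<noteq> A" if "(z, y) \<in> r" "z \<noteq> y" for z using that ymin anti rX by blast
    have "y \<noteq> x0" using y A(2) by blast
    moreover have "\<nexists>z. successor r z y"
    proof
      assume "\<exists>z. successor r z y"
      then obtain z where z: "successor r z y" by blast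
      have zy: "(z, y) \<in> r" "z \<noteq> y" using z unfolding successor_def by auto
      have "successor r' (f z) A"
      proof -
        have "C = f z \<or> C = A" if C: "(f z, C) \<in> r'" "(C, A) \<in> r'" for C
        proof -
          obtain c where c: "c \<in> X" "f c = C" using C unfolding r'_def by blast
          consider "(c, z) \<in> r" | "(y, c) \<in> r"
            using tot[OF c(1) y(1)] tot[OF c(1), of z] z rX[OF zy(1)] unfolding successor_def by blast
          then show ?thesis
            using mono[of c z] mono[of y c] C c y unfolding r'_def by cases blast+
        qed
        moreover have "(f z, A) \<in> r'" using mono zy rX y A(1) unfolding r'_def by blast
        ultimately show ?thesis using ne[OF zy] unfolding successor_def by blast
      qed
      then show False using A(3) by blast
    qed
    ultimately have "f y = (\<Union>z\<in>{z. (z, y) \<in> r \<and> z \<noteq> y}. f z)" using lim y(1) by blast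
    moreover have "(f z, A) \<in> r' \<and> f z \<noteq> A" if "(z, y) \<in> r" "z \<noteq> y" for z
      using that ne mono rX y A(1) unfolding r'_def by blast
    ultimately have "A \<subseteq> \<Union>{B. (B, A) \<in> r' \<and> B \<noteq> A}" using y(2) by blast
    then show ?thesis unfolding r'_def by blast
  qed
  have "strongly_ascending_series p T S r' id"
    unfolding strongly_ascending_series_def field
  proof (rule conjI, rule wo'[unfolded field],
      rule bexI[of _ "f x0"], rule bexI[of _ "f x1"], intro conjI)
    show "\<forall>x\<in>f ` X. (f x0, x) \<in> r' \<and> (x, f x1) \<in> r'"
      using bnd mono x0 x1 unfolding r'_def by blast
    show "\<forall>x x'. successor r' x x' \<longrightarrow>
         id x \<lhd> T\<lparr>carrier := id x'\<rparr> \<and>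
         finite (rcosets\<^bsub>T\<lparr>carrier := id x'\<rparr>\<^esub> (id x)) \<and>
         \<not> p dvd card (rcosets\<^bsub>T\<lparr>carrier := id x'\<rparr>\<^esub> (id x))"
      using succ succ' by fastforce
    show "\<forall>x\<in>f ` X. x \<noteq> f x0 \<and> (\<nexists>y. successor r' y x) \<longrightarrow>
       id x = (\<Union>y\<in>{y. (y, x) \<in> r' \<and> y \<noteq> x}. id y)"
      using lim' by simp
  qed (use f0 f1 sub x0 x1 in auto)
  then show ?thesis unfolding strongly_ascendant_def by blast
qed


section \<open>The constructions above satisfy what they are introduced for\<close>

lemma mmult_unit:
  "mmult (unit_mat r \<alpha> \<beta>) (unit_mat s \<gamma> \<delta>) =
     (if \<beta> = \<gamma> then unit_mat (r * s) \<alpha> \<delta> else (\<lambda>_ _. 0))"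
proof (intro ext)
  fix a c
  have "Sum_any (\<lambda>b. unit_mat r \<alpha> \<beta> a b * unit_mat s \<gamma> \<delta> b c) =
        (\<Sum>b\<in>{\<beta>}. unit_mat r \<alpha> \<beta> a b * unit_mat s \<gamma> \<delta> b c)"
    by (rule Sum_any.expand_superset) (auto simp: unit_mat_def)
  then show "mmult (unit_mat r \<alpha> \<beta>) (unit_mat s \<gamma> \<delta>) a c =
     (if \<beta> = \<gamma> then unit_mat (r * s) \<alpha> \<delta> else (\<lambda>_ _. 0)) a c"
    by (auto simp: mmult_def unit_mat_def)
qed

definition row_finite :: "('a, 'r::ring_1) mat \<Rightarrow> bool" where
  "row_finite A \<longleftrightarrow> (\<forall>a. finite {b. A a b \<noteq> 0})"

lemma mmult_superset:
  assumes "finite V" "{b. A a b \<noteq> 0} \<subseteq> V"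
  shows "mmult A B a c = (\<Sum>b\<in>V. A a b * B b c)"
  unfolding mmult_def using assms by (intro Sum_any.expand_superset) auto

lemma mmult_nonzeroE:
  assumes "mmult A B a c \<noteq> 0"
  obtains b where "A a b \<noteq> 0" "B b c \<noteq> 0"
proof (rule ccontr)
  assume "\<not> thesis"
  then have "A a b * B b c = 0" for b using that by (metis mult_zero_left mult_zero_right)
  then show False using assms unfolding mmult_def by simp
qed

lemma row_finite_mone: "row_finite mone"
  unfolding row_finite_def mone_def by simp

lemma row_finite_madd: "row_finite A \<Longrightarrow> row_finite B \<Longrightarrow> row_finite (madd A B)"
  unfolding row_finite_def
proof
  fix a assume "\<forall>a. finite {b. A a b \<noteq> 0}" "\<forall>a. finite {b. B a b \<noteq> 0}"
  then have "finite ({b. A a b \<noteq> 0} \<union> {b. B a b \<noteq> 0})" by simp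
  then show "finite {b. madd A B a b \<noteq> 0}"
    by (rule rev_finite_subset) (auto simp: madd_def)
qed

lemma row_finite_mmult:
  assumes "row_finite A" "row_finite B"
  shows "row_finite (mmult A B)"
  unfolding row_finite_def
proof
  fix a
  let ?V = "{b. A a b \<noteq> 0}"
  have "mmult A B a c = (\<Sum>b\<in>?V. A a b * B b c)" for c
    using assms by (intro mmult_superset) (auto simp: row_finite_def)
  then have "{c. mmult A B a c \<noteq> 0} \<subseteq> (\<Union>b\<in>?V. {c. B b c \<noteq> 0})"
    by (auto elim!: sum.not_neutral_contains_not_neutral)
  then show "finite {c. mmult A B a c \<noteq> 0}"
    using assms unfolding row_finite_def by (meson finite_UN finite_subset)
qed

lemma mmult_assoc:
  assumes "row_finite A" "row_finite B"
  shows "mmult (mmult A B) C = mmult A (mmult B C)"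
proof (intro ext)
  fix a d
  let ?V = "{b. A a b \<noteq> 0}"
  let ?W = "\<Union>b\<in>?V. {c. B b c \<noteq> 0}"
  have fin: "finite ?V" "finite ?W" using assms unfolding row_finite_def by auto
  have AB: "mmult A X a c = (\<Sum>b\<in>?V. A a b * X b c)" for c X
    using fin by (intro mmult_superset) auto
  have sub: "{c. mmult A B a c \<noteq> 0} \<subseteq> ?W"
    unfolding AB by (auto elim!: sum.not_neutral_contains_not_neutral)
  have "mmult (mmult A B) C a d = (\<Sum>c\<in>?W. (\<Sum>b\<in>?V. A a b * B b c) * C c d)"
    using mmult_superset[of ?W "mmult A B" a C d, OF fin(2) sub] unfolding AB .
  also have "\<dots> = (\<Sum>b\<in>?V. A a b * (\<Sum>c\<in>?W. B b c * C c d))"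
    by (simp add: sum_distrib_left sum_distrib_right mult.assoc sum.swap[of _ ?V])
  also have "\<dots> = (\<Sum>b\<in>?V. A a b * mmult B C b d)"
  proof (rule sum.cong[OF refl])
    fix b assume "b \<in> ?V"
    then have "mmult B C b d = (\<Sum>c\<in>?W. B b c * C c d)"
      using fin by (intro mmult_superset) auto
    then show "A a b * (\<Sum>c\<in>?W. B b c * C c d) = A a b * mmult B C b d" by simp
  qed
  finally show "mmult (mmult A B) C a d = mmult A (mmult B C) a d" unfolding AB .
qed

lemma mmult_mone_left: "mmult mone A = A"
proof (intro ext)
  fix a c
  show "mmult mone A a c = A a c"
    by (subst mmult_superset[of "{a}"]) (auto simp: mone_def)
qed

lemma mmult_mone_right:
  assumes "row_finite A"
  shows "mmult A mone = A"
proof (intro ext)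
  fix a c
  have "finite (insert c {b. A a b \<noteq> 0})" using assms unfolding row_finite_def by simp
  then have "mmult A mone a c = (\<Sum>b\<in>insert c {b. A a b \<noteq> 0}. A a b * mone b c)"
    by (intro mmult_superset) auto
  also have "\<dots> = (\<Sum>b\<in>{c}. A a b * mone b c)"
    using \<open>finite _\<close> by (intro sum.mono_neutral_right) (auto simp: mone_def)
  finally show "mmult A mone a c = A a c" by (simp add: mone_def)
qed

lemma mmult_madd_left:
  assumes "row_finite A" "row_finite B"
  shows "mmult (madd A B) C = madd (mmult A C) (mmult B C)"
proof (intro ext)
  fix a c
  let ?V = "{b. A a b \<noteq> 0} \<union> {b. B a b \<noteq> 0}"
  have fin: "finite ?V" using assms unfolding row_finite_def by simp
  show "mmult (madd A B) C a c = madd (mmult A C) (mmult B C) a c"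
    unfolding madd_def[of "mmult A C"]
    using fin by (subst (1 2 3) mmult_superset[of ?V])
      (auto simp: madd_def distrib_right sum.distrib)
qed

lemma mmult_madd_right:
  assumes "row_finite A"
  shows "mmult A (madd B C) = madd (mmult A B) (mmult A C)"
proof (intro ext)
  fix a c
  let ?V = "{b. A a b \<noteq> 0}"
  have fin: "finite ?V" using assms unfolding row_finite_def by simp
  show "mmult A (madd B C) a c = madd (mmult A B) (mmult A C) a c"
    unfolding madd_def[of "mmult A B"]
    using fin by (subst (1 2 3) mmult_superset[of ?V])
      (auto simp: madd_def distrib_left sum.distrib)
qed

lemma J_row_finite: "x \<in> J \<Longrightarrow> row_finite x"
  unfolding row_finite_def
proof
  fix a assume "x \<in> J"
  then have "finite (snd ` {(a, b). x a b \<noteq> 0})" unfolding J_def by blast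
  then show "finite {b. x a b \<noteq> 0}" by (rule rev_finite_subset) force
qed

lemma J_zero: "(\<lambda>_ _. 0) \<in> J"
  unfolding J_def by simp

lemma J_uminus: "x \<in> J \<Longrightarrow> (\<lambda>a b. - x a b) \<in> J"
  unfolding J_def by simp

lemma J_madd:
  assumes "x \<in> J" "y \<in> J"
  shows "madd x y \<in> J"
proof -
  have "{(a, b). madd x y a b \<noteq> 0} \<subseteq> {(a, b). x a b \<noteq> 0} \<union> {(a, b). y a b \<noteq> 0}"
    unfolding madd_def by auto
  then show ?thesis using assms unfolding J_def by (auto intro: finite_subset)
qed

lemma J_mmult:
  assumes "x \<in> J" "y \<in> J"
  shows "mmult x y \<in> J"
proof -
  let ?X = "{(a, b). x a b \<noteq> 0}" and ?Y = "{(a, b). y a b \<noteq> 0}"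
  have *: "\<exists>b. x a b \<noteq> 0 \<and> y b c \<noteq> 0" if "mmult x y a c \<noteq> 0" for a c
    using mmult_nonzeroE[OF that] by blast
  then have "{(a, c). mmult x y a c \<noteq> 0} \<subseteq> fst ` ?X \<times> snd ` ?Y"
    by (force simp: image_iff)
  moreover have "finite (fst ` ?X \<times> snd ` ?Y)" using assms unfolding J_def by auto
  moreover have "{(a, c). mmult x y a c \<noteq> 0} \<subseteq> Phi"
  proof clarify
    fix a c assume "mmult x y a c \<noteq> 0"
    then obtain b where "x a b \<noteq> 0" "y b c \<noteq> 0" using * by blast
    then have "a < b" "b < c" using assms unfolding J_def Phi_def by auto
    then show "(a, c) \<in> Phi" unfolding Phi_def by auto
  qed
  ultimately show ?thesis unfolding J_def by (auto intro: finite_subset)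
qed

fun mpow :: "('a, 'r::ring_1) mat \<Rightarrow> nat \<Rightarrow> ('a, 'r) mat" where
  "mpow x 0 = mone"
| "mpow x (Suc n) = mmult (mpow x n) x"

lemma J_nil:
  fixes x :: "('a::linorder, 'r::ring_1) mat"
  assumes "x \<in> J"
  shows "\<exists>n. mpow x (Suc n) = (\<lambda>_ _. 0)"
proof -
  define V where "V = fst ` {(a, b). x a b \<noteq> 0}"
  have "finite V" using assms unfolding J_def V_def by auto
  have chain: "n \<le> card {v \<in> V. a \<le> v \<and> v < b}" if "mpow x n a b \<noteq> 0" for n a b
    using that
  proof (induction n arbitrary: b)
    case (Suc n)
    obtain c where c: "mpow x n a c \<noteq> 0" "x c b \<noteq> 0"
      using Suc.prems mmult_nonzeroE[of "mpow x n" x a b] by auto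
    have "c < b" using c(2) assms unfolding J_def Phi_def by auto
    have le: "a \<le> c" using c(1)
    proof (induction n arbitrary: c)
      case 0 then show ?case by (auto simp: mone_def split: if_splits)
    next
      case (Suc m)
      obtain d where d: "mpow x m a d \<noteq> 0" "x d c \<noteq> 0"
        using Suc.prems mmult_nonzeroE[of "mpow x m" x a c] by auto
      then have "a \<le> d" using Suc.IH by blast
      moreover have "d < c" using d(2) assms unfolding J_def Phi_def by auto
      ultimately show ?case by simp
    qed
    have "c \<in> V" using c(2) unfolding V_def by force
    have "insert c {v \<in> V. a \<le> v \<and> v < c} \<subseteq> {v \<in> V. a \<le> v \<and> v < b}"
      using \<open>c < b\<close> \<open>c \<in> V\<close> le by auto
    then have "card (insert c {v \<in> V. a \<le> v \<and> v < c}) \<le> card {v \<in> V. a \<le> v \<and> v < b}"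
      using \<open>finite V\<close> by (intro card_mono) auto
    then show ?case using Suc.IH[OF c(1)] \<open>finite V\<close> by simp
  qed simp
  have "mpow x (Suc (card V)) a b = 0" for a b
  proof (rule ccontr)
    assume "mpow x (Suc (card V)) a b \<noteq> 0"
    from chain[OF this] have "Suc (card V) \<le> card {v \<in> V. a \<le> v \<and> v < b}" .
    also have "\<dots> \<le> card V" using \<open>finite V\<close> by (intro card_mono) auto
    finally show False by simp
  qed
  then show ?thesis by blast
qed

lemma mpow_J: "x \<in> J \<Longrightarrow> mpow x (Suc n) \<in> J"
proof (induction n)
  case 0 then show ?case by (simp add: mmult_mone_left)
next
  case (Suc n) then show ?case using J_mmult by (subst mpow.simps) blast
qed

lemma group_McLain: "group (McLain :: ('a::linorder, 'r::ring_1) mat monoid)"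
proof -
  let ?M = "McLain :: ('a, 'r) mat monoid"
  have rf: "row_finite A" if "A \<in> carrier ?M" for A
    using that by (auto simp: McLain_def intro: row_finite_madd row_finite_mone J_row_finite)
  have prod: "mmult (madd mone x) (madd mone y) = madd mone (madd x (madd y (mmult x y)))"
    if "x \<in> J" "y \<in> J" for x y :: "('a, 'r) mat"
    using J_row_finite[OF that(1)]
    by (simp add: mmult_madd_left mmult_madd_right mmult_mone_left mmult_mone_right row_finite_mone
        J_row_finite that) (auto simp: madd_def fun_eq_iff)
  show ?thesis
  proof (rule groupI)
    fix A B assume "A \<in> carrier ?M" "B \<in> carrier ?M"
    then show "A \<otimes>\<^bsub>?M\<^esub> B \<in> carrier ?M"
      by (auto simp: McLain_def prod) (blast intro: J_madd J_mmult)
  next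
    have "(mone :: ('a, 'r) mat) = madd mone (\<lambda>_ _. 0)" by (simp add: madd_def)
    then show "\<one>\<^bsub>?M\<^esub> \<in> carrier ?M" using J_zero by (auto simp: McLain_def)
  next
    fix A B C assume "A \<in> carrier ?M" "B \<in> carrier ?M" "C \<in> carrier ?M"
    then show "A \<otimes>\<^bsub>?M\<^esub> B \<otimes>\<^bsub>?M\<^esub> C = A \<otimes>\<^bsub>?M\<^esub> (B \<otimes>\<^bsub>?M\<^esub> C)"
      using rf by (simp add: McLain_def mmult_assoc)
  next
    fix A assume "A \<in> carrier ?M"
    then show "\<one>\<^bsub>?M\<^esub> \<otimes>\<^bsub>?M\<^esub> A = A" by (simp add: McLain_def mmult_mone_left)
  next
    fix A assume "A \<in> carrier ?M"
    then obtain x where x: "x \<in> J" "A = madd mone x" by (auto simp: McLain_def)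
    define y where "y = (\<lambda>a b. - x a b)"
    have y: "y \<in> J" using J_uminus x unfolding y_def by blast
    define s :: "nat \<Rightarrow> ('a, 'r) mat" where "s n = (\<lambda>a b. \<Sum>k\<le>n. mpow y k a b)" for n
    have s_Suc: "s (Suc n) = madd (s n) (mpow y (Suc n))" for n
      unfolding s_def madd_def by simp
    have s: "s n \<in> carrier ?M" for n
    proof (induction n)
      case 0
      have "s 0 = madd mone (\<lambda>_ _. 0)" by (simp add: s_def madd_def)
      then show ?case using J_zero by (auto simp: McLain_def)
    next
      case (Suc n)
      then obtain z where "z \<in> J" "s n = madd mone z" by (auto simp: McLain_def)
      then have "s (Suc n) = madd mone (madd z (mpow y (Suc n)))"
        unfolding s_Suc by (auto simp: madd_def fun_eq_iff)
      then show ?case using J_madd \<open>z \<in> J\<close> mpow_J[OF y] by (auto simp: McLain_def)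
    qed
    have tel: "madd (mmult (s n) A) (mpow y (Suc n)) = mone" for n
    proof (induction n)
      case 0
      then show ?case using x unfolding s_def
        by (auto simp: mmult_mone_left madd_def y_def fun_eq_iff)
    next
      case (Suc n)
      define P where "P = mpow y (Suc n)"
      have P: "row_finite P" using J_row_finite mpow_J y unfolding P_def by blast
      have "mmult P (madd x y) = madd (mmult P x) (mmult P y)"
        using mmult_madd_right P by blast
      moreover have "madd x y = (\<lambda>_ _. 0)" unfolding madd_def y_def by simp
      moreover have "mmult P (\<lambda>_ _. 0) = (\<lambda>_ _. 0)" unfolding mmult_def by simp
      ultimately have PP: "madd (mmult P x) (mmult P y) = (\<lambda>_ _. 0)" by simp
      have "mmult (s (Suc n)) A = madd (mmult (s n) A) (madd P (mmult P x))"
        unfolding s_Suc P_def[symmetric] x(2)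
        using P rf[OF s] by (simp add: mmult_madd_left mmult_madd_right mmult_mone_right)
      moreover have "mpow y (Suc (Suc n)) = mmult P y" unfolding P_def by simp
      ultimately show ?case using Suc.IH PP unfolding P_def[symmetric]
        by (simp add: madd_def fun_eq_iff) (simp add: add.assoc)
    qed
    obtain n where "mpow y (Suc n) = (\<lambda>_ _. 0)" using J_nil y by blast
    then have "s n \<otimes>\<^bsub>?M\<^esub> A = \<one>\<^bsub>?M\<^esub>"
      using tel[of n] by (simp add: madd_def McLain_def)
    then show "\<exists>B\<in>carrier ?M. B \<otimes>\<^bsub>?M\<^esub> A = \<one>\<^bsub>?M\<^esub>"
      using s by blast
  qed
qed

lemma closed_Gamma1:
  assumes "basic_subset D"
  shows "closed_rel (Gamma1 D)"
proof -
  have uniq: "b = b'" if "(a, b) \<in> D" "(a, b') \<in> D" for a b b'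
    using assms that unfolding basic_subset_def inj_on_def by force
  have "(a, c) \<in> Gamma1 D" if ab: "(a, b) \<in> Gamma1 D" and bc: "(b, c) \<in> Gamma1 D" for a b c
  proof -
    have lt: "a < b" "b < c" using ab bc unfolding Gamma1_def Gamma_def Omega_def Phi_def by auto
    have split: "(u, v) \<in> Gamma1 D \<longleftrightarrow> u < v \<and>
       ((\<forall>\<beta>. (u, \<beta>) \<in> D \<longrightarrow> \<beta> \<le> v) \<or>
        (\<exists>\<beta> \<delta>. (u, \<beta>) \<in> D \<and> (v, \<delta>) \<in> D \<and> v < \<beta> \<and> \<beta> < \<delta>))" for u v
      unfolding Gamma1_def Gamma_def Omega_def Phi_def by (auto simp: not_less)
    have "a < c" using lt by simp
    show ?thesis
    proof (cases "\<exists>\<beta>. (a, \<beta>) \<in> D \<and> c < \<beta>")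
      case False
      then show ?thesis using \<open>a < c\<close> unfolding split by (meson not_less)
    next
      case True
      then obtain \<beta> where \<beta>: "(a, \<beta>) \<in> D" "c < \<beta>" by blast
      have "\<not> \<beta> \<le> b" using \<beta> lt by simp
      then obtain \<delta> where \<delta>: "(b, \<delta>) \<in> D" "\<beta> < \<delta>"
        using ab \<beta>(1) uniq unfolding split by blast
      have "\<not> \<delta> \<le> c" using \<beta> \<delta> by simp
      then obtain \<epsilon> where \<epsilon>: "(c, \<epsilon>) \<in> D" "\<delta> < \<epsilon>"
        using bc \<delta>(1) uniq unfolding split by blast
      have "\<beta> < \<epsilon>" using \<delta> \<epsilon> by simp
      then show ?thesis using \<open>a < c\<close> \<beta> \<epsilon> unfolding split by blast
    qed
  qed
  moreover have "Gamma1 D \<subseteq> Phi" unfolding Gamma1_def Gamma_def Omega_def by blast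
  ultimately show ?thesis unfolding closed_rel_def by blast
qed

end

theory Submission
  imports Defs "HOL-Algebra.Sylow" "HOL-Algebra.Multiplicative_Group"
begin

text \<open>
  For closed \<open>\<Delta>\<close>, \<open>M(\<Delta>)\<close> consists of the matrices of \<open>M\<close> supported on \<open>\<Delta>\<close> and the diagonal. If
  \<open>\<Delta>\<close> and \<open>\<Delta> \<union> {(a, c)}\<close> are closed and \<open>(a, c) \<notin> \<Delta>\<close>, then \<open>A \<mapsto> A a c\<close> is a homomorphism
  from \<open>M(\<Delta> \<union> {(a, c)})\<close> onto the additive group of \<open>R\<close> with kernel \<open>M(\<Delta>)\<close>, so the index is
  \<open>|R|\<close>; this is prime to \<open>char F\<close>, since otherwise \<open>{r. p r = 0}\<close> would be a nonzero ideal on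
  which every \<open>F\<close>-character is trivial. It remains to adjoin the positions outside \<open>\<Gamma>\<^sub>1\<close> to \<open>\<Gamma>\<^sub>1\<close>
  one at a time, through closed sets: take the finitely many rows in increasing order and, within
  a row, the columns in decreasing order, which is a well-order by hypothesis.
\<close>

section \<open>The order of the coefficient ring\<close>

definition additive_group :: "'r::ab_group_add monoid" where
  "additive_group = \<lparr>carrier = UNIV, monoid.mult = (+), one = 0\<rparr>"

lemma group_additive_group: "group additive_group"
proof (rule groupI)
  fix x :: 'a assume "x \<in> carrier additive_group"
  show "\<exists>y\<in>carrier additive_group. y \<otimes>\<^bsub>additive_group\<^esub> x = \<one>\<^bsub>additive_group\<^esub>"
    by (rule bexI[of _ "- x"]) (auto simp: additive_group_def)
qed (auto simp: additive_group_def add.assoc)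

lemma additive_group_pow:
  fixes x :: "'r::ring_1"
  shows "x [^]\<^bsub>additive_group\<^esub> (n::nat) = of_nat n * x"
  by (induction n) (simp_all add: nat_pow_def additive_group_def distrib_right add.commute)

text \<open>Cauchy's theorem for the additive group, drawn from Sylow: a subgroup of order
  \<open>p\<close> is nontrivial and is killed by \<open>p\<close>.\<close>

lemma exists_prime_torsion:
  assumes "finite (UNIV :: 'r::ring_1 set)" "prime p" "p dvd card (UNIV :: 'r set)"
  shows "\<exists>x::'r. x \<noteq> 0 \<and> of_nat p * x = 0"
proof -
  let ?G = "additive_group :: 'r monoid"
  interpret group ?G by (rule group_additive_group)
  have "carrier ?G = UNIV" by (simp add: additive_group_def)
  moreover obtain m where "card (UNIV :: 'r set) = p ^ 1 * m" using assms(3) by auto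
  ultimately have "\<exists>H. subgroup H ?G \<and> card H = p ^ 1"
    using sylow_thm[OF assms(2) is_group, of 1 m] assms(1) by (simp add: Coset.order_def)
  then obtain H where H: "subgroup H ?G" "card H = p" by auto
  interpret H: group "?G\<lparr>carrier := H\<rparr>" using subgroup_imp_group[OF H(1)] .
  have "\<not> H \<subseteq> {0}"
  proof
    assume "H \<subseteq> {0}"
    then have "card H \<le> card {0::'r}" by (intro card_mono) auto
    then show False using H(2) prime_gt_1_nat[OF assms(2)] by simp
  qed
  then obtain x where x: "x \<in> H" "x \<noteq> 0" by blast
  have "x [^]\<^bsub>?G\<^esub> p = \<one>\<^bsub>?G\<^esub>"
    using H.pow_order_eq_1[of x] x(1) H(2) by (simp add: Coset.order_def nat_pow_consistent[symmetric])
  then have "of_nat p * x = 0" unfolding additive_group_pow by (simp add: additive_group_def)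
  then show ?thesis using x(2) by blast
qed

section \<open>Roots of unity and values of characters\<close>

lemma prime_CHAR_power_eq_1_iff:
  fixes x :: "'f::field"
  assumes "prime CHAR('f)"
  shows "x ^ CHAR('f) = 1 \<longleftrightarrow> x = 1"
proof -
  \<comment> \<open>Frobenius applied to \<open>(x - 1) + 1\<close>; as a field has no nonzero
    nilpotents, \<open>x ^ CHAR('f) = 1\<close> then forces \<open>x = 1\<close>.\<close>
  have "x ^ CHAR('f) = (x - 1) ^ CHAR('f) + 1"
    using freshmans_dream[OF assms refl, of "x - 1" 1] by simp
  then show ?thesis using prime_gt_0_nat[OF assms] by simp
qed

lemma linear_character_of_nat_mult:
  fixes \<chi> :: "'r::ring_1 \<Rightarrow> 'f::field"
  assumes "linear_character \<chi>"
  shows "\<chi> (of_nat n * x) = \<chi> x ^ n"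
proof (induction n)
  case 0
  have "\<chi> (0 + 0) = \<chi> 0 * \<chi> 0" "\<chi> 0 \<noteq> 0" using assms unfolding linear_character_def by blast+
  then show ?case by simp
next
  case (Suc n)
  then show ?case using assms by (simp add: linear_character_def distrib_right)
qed

lemma right_primitive_CHAR_not_dvd_card:
  fixes \<chi> :: "'r::ring_1 \<Rightarrow> 'f::field"
  assumes "right_primitive \<chi>" "finite (UNIV :: 'r set)"
  shows "\<not> CHAR('f) dvd card (UNIV :: 'r set)"
proof
  assume dvd: "CHAR('f) dvd card (UNIV :: 'r set)"
  \<comment> \<open>Characteristic 0 is excluded first: 0 divides no positive number.\<close>
  have "CHAR('f) \<noteq> 0"
    using dvd assms(2) by (metis UNIV_not_empty card_eq_0_iff dvd_0_left)
  then have p: "prime CHAR('f)" by (simp add: prime_CHAR_semidom)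
  define K :: "'r set" where "K = {x. of_nat CHAR('f) * x = 0}"
  have "right_ideal K"
    unfolding right_ideal_def K_def by (simp add: right_diff_distrib flip: mult.assoc)
  moreover have "K \<subseteq> {a. \<chi> a = 1}"
  proof
    fix x assume "x \<in> K"
    have lin: "linear_character \<chi>" using assms(1) unfolding right_primitive_def by blast
    \<comment> \<open>Writing 0 as \<open>of_nat 0 * x\<close> lets
      \<open>linear_character_of_nat_mult\<close> serve twice: for the power on the left and for
      \<open>\<chi> 0 = 1\<close>.\<close>
    have "\<chi> x ^ CHAR('f) = \<chi> (of_nat 0 * x)"
      unfolding linear_character_of_nat_mult[OF lin, symmetric] using \<open>x \<in> K\<close>
      by (simp add: K_def)
    also have "\<dots> = 1" unfolding linear_character_of_nat_mult[OF lin] by simp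
    finally show "x \<in> {a. \<chi> a = 1}" using prime_CHAR_power_eq_1_iff[OF p] by simp
  qed
  ultimately have "K = {0}" using assms(1) unfolding right_primitive_def by blast
  then show False using exists_prime_torsion[OF assms(2) p dvd] unfolding K_def by blast
qed

section \<open>Subgroups given by closed sets of positions\<close>

text \<open>Stand-in for \<open>M_of\<close> in which membership is tested entry by entry; for
  closed sets the two agree by \<open>M_of_eq_supported\<close>.\<close>

definition supported :: "('a::linorder \<times> 'a) set \<Rightarrow> ('a, 'r::ring_1) mat set" where
  "supported \<Delta> = {A \<in> carrier McLain. \<forall>a b. a \<noteq> b \<and> A a b \<noteq> 0 \<longrightarrow> (a, b) \<in> \<Delta>}"

lemma McLain_mult [simp]: "A \<otimes>\<^bsub>McLain\<^esub> B = mmult A B"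
  and McLain_one [simp]: "\<one>\<^bsub>McLain\<^esub> = mone"
  by (simp_all add: McLain_def)

lemma mem_McLain_iff:
  "A \<in> carrier McLain \<longleftrightarrow> (\<forall>a. A a a = 1) \<and> (\<forall>a b. b < a \<longrightarrow> A a b = 0) \<and>
     finite {(a, b). a \<noteq> b \<and> A a b \<noteq> 0}" (is "?L \<longleftrightarrow> ?R")
proof
  assume ?L
  then obtain x where x: "x \<in> J" "A = madd mone x" by (auto simp: McLain_def)
  have z: "x a b = 0" if "b \<le> a" for a b using x(1) that unfolding J_def Phi_def by fastforce
  have "{(a, b). a \<noteq> b \<and> A a b \<noteq> 0} \<subseteq> {(a, b). x a b \<noteq> 0}"
    unfolding x(2) by (auto simp: madd_def mone_def)
  moreover have "finite {(a, b). x a b \<noteq> 0}" using x(1) unfolding J_def by blast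
  ultimately have "finite {(a, b). a \<noteq> b \<and> A a b \<noteq> 0}" by (rule finite_subset)
  moreover have "A a a = 1" "b < a \<Longrightarrow> A a b = 0" for a b
    using z[of a a] z[of b a] unfolding x(2) by (auto simp: madd_def mone_def)
  ultimately show ?R by blast
next
  assume R: ?R
  define x where "x = (\<lambda>a b. if a = b then 0 else A a b)"
  have "{(a, b). x a b \<noteq> 0} = {(a, b). a \<noteq> b \<and> A a b \<noteq> 0}" unfolding x_def by auto
  then have "x \<in> J" using R unfolding J_def Phi_def
    by (auto simp: x_def not_less_iff_gr_or_eq split: if_splits)
  moreover have "A = madd mone x"
    using R by (auto simp: madd_def mone_def x_def fun_eq_iff)
  ultimately show ?L by (auto simp: McLain_def)
qed

lemma McLain_diag: "A \<in> carrier McLain \<Longrightarrow> A a a = 1"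
  by (simp add: mem_McLain_iff)

lemma McLain_upper: "A \<in> carrier McLain \<Longrightarrow> A a b \<noteq> 0 \<Longrightarrow> a \<le> b"
  by (meson mem_McLain_iff not_le)

text \<open>Serves both to control inverses and to show that a single entry is additive: in each
  case closedness kills every intermediate term.\<close>

lemma mmult_eq_two:
  assumes "a \<noteq> c" "\<And>b. b \<noteq> a \<Longrightarrow> b \<noteq> c \<Longrightarrow> A a b * B b c = 0"
  shows "mmult A B a c = A a a * B a c + A a c * B c c"
proof -
  have "mmult A B a c = (\<Sum>b\<in>{a, c}. A a b * B b c)"
    unfolding mmult_def by (rule Sum_any.expand_superset) (use assms(2) in auto)
  then show ?thesis using assms(1) by simp
qed

lemma supportedD: "A \<in> supported \<Delta> \<Longrightarrow> A a b \<noteq> 0 \<Longrightarrow> a \<noteq> b \<Longrightarrow> (a, b) \<in> \<Delta>"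
  unfolding supported_def by blast

lemma supported_mono: "\<Delta> \<subseteq> \<Delta>' \<Longrightarrow> supported \<Delta> \<subseteq> supported \<Delta>'"
  unfolding supported_def by blast

lemma supported_Phi: "supported Phi = carrier McLain"
  using McLain_upper unfolding supported_def Phi_def by fastforce

text \<open>A nonzero entry of a product comes from a path of two positions, so transitivity handles
  products. For an inverse \<open>B\<close> of \<open>A\<close>, an offending position in the
  largest possible row would survive as a nonzero off-diagonal entry of
  \<open>mmult A B = mone\<close>.\<close>

lemma subgroup_supported:
  assumes "closed_rel \<Delta>"
  shows "subgroup (supported \<Delta> :: ('a::linorder, 'r::ring_1) mat set) McLain"
proof -
  interpret group "McLain :: ('a, 'r) mat monoid" by (rule group_McLain)
  have tr: "(a, c) \<in> \<Delta>" if "(a, b) \<in> \<Delta>" "(b, c) \<in> \<Delta>" for a b c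
    using assms that unfolding closed_rel_def by blast
  show ?thesis
  proof
    show "supported \<Delta> \<subseteq> carrier (McLain :: ('a, 'r) mat monoid)"
      unfolding supported_def by blast
    show "\<one>\<^bsub>McLain\<^esub> \<in> (supported \<Delta> :: ('a, 'r) mat set)"
      using one_closed unfolding supported_def by (auto simp: mone_def)
  next
    fix A B :: "('a, 'r) mat" assume AB: "A \<in> supported \<Delta>" "B \<in> supported \<Delta>"
    then have c: "mmult A B \<in> carrier McLain" using m_closed unfolding supported_def by fastforce
    have "(a, c) \<in> \<Delta>" if ac: "a \<noteq> c" "mmult A B a c \<noteq> 0" for a c
    proof -
      obtain b where b: "A a b \<noteq> 0" "B b c \<noteq> 0" using mmult_nonzeroE[OF ac(2)] .
      show ?thesis
        using supportedD[OF AB(1) b(1)] supportedD[OF AB(2) b(2)] ac(1) tr[of a b c]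
        by (cases "a = b"; cases "b = c") simp_all
    qed
    then show "A \<otimes>\<^bsub>McLain\<^esub> B \<in> supported \<Delta>" using c unfolding supported_def by simp
  next
    fix A :: "('a, 'r) mat" assume A: "A \<in> supported \<Delta>"
    define B where "B = inv\<^bsub>McLain\<^esub> A"
    have Ac: "A \<in> carrier McLain" using A unfolding supported_def by blast
    then have B: "B \<in> carrier McLain" "mmult A B = mone"
      using inv_closed r_inv unfolding B_def by auto
    define Bad where "Bad = {(a, c). a \<noteq> c \<and> B a c \<noteq> 0} - \<Delta>"
    have "finite (fst ` Bad)" using B(1) unfolding Bad_def mem_McLain_iff by blast
    have "Bad = {}"
    proof (rule ccontr)
      assume "Bad \<noteq> {}"
      then have "Max (fst ` Bad) \<in> fst ` Bad" using \<open>finite (fst ` Bad)\<close> by simp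
      then obtain c where ac: "(Max (fst ` Bad), c) \<in> Bad" by auto
      define a where "a = Max (fst ` Bad)"
      have bad: "a \<noteq> c" "B a c \<noteq> 0" "(a, c) \<notin> \<Delta>" using ac unfolding a_def Bad_def by auto
      \<comment> \<open>A nonzero term has \<open>a < b\<close>, so by maximality of
        \<open>a\<close> the position \<open>(b, c)\<close> is not in \<open>Bad\<close>;
        transitivity would then put \<open>(a, c)\<close> into \<open>\<Delta>\<close>.\<close>
      have "A a b * B b c = 0" if "b \<noteq> a" "b \<noteq> c" for b
      proof (rule ccontr)
        assume "A a b * B b c \<noteq> 0"
        then have nz: "A a b \<noteq> 0" "B b c \<noteq> 0" by auto
        have ab: "(a, b) \<in> \<Delta>" using supportedD[OF A nz(1)] that by simp
        have "a < b" using McLain_upper[OF Ac nz(1)] that by auto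
        then have "(b, c) \<notin> Bad"
          using Max_ge[OF \<open>finite (fst ` Bad)\<close>, of b] unfolding a_def by force
        then have "(b, c) \<in> \<Delta>" using nz that unfolding Bad_def by auto
        then show False using tr ab bad by blast
      qed
      moreover have "A a c = 0" using supportedD[OF A] bad by blast
      ultimately have "mmult A B a c = B a c"
        using mmult_eq_two[OF bad(1), of A B] McLain_diag[OF Ac] by simp
      then show False using bad B(2) by (simp add: mone_def)
    qed
    then show "inv\<^bsub>McLain\<^esub> A \<in> supported \<Delta>"
      using B(1) unfolding B_def[symmetric] supported_def Bad_def by auto
  qed
qed

section \<open>Generation by root subgroups\<close>

lemma root_elem_mem_supported:
  assumes "(a, c) \<in> \<Delta>" "a < c"
  shows "madd mone (unit_mat r a c) \<in> supported \<Delta>"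
proof -
  have "unit_mat r a c \<in> J"
    using assms(2) unfolding J_def Phi_def unit_mat_def
    by (auto intro: finite_subset[of _ "{(a, c)}"] split: if_splits)
  then show ?thesis using assms unfolding supported_def
    by (auto simp: McLain_def madd_def mone_def unit_mat_def split: if_splits)
qed

text \<open>One inclusion is checked on generators. The other peels off root elements, by induction
  on the number of nonzero off-diagonal entries.\<close>

lemma M_of_eq_supported:
  assumes "closed_rel \<Delta>"
  shows "M_of \<Delta> = (supported \<Delta> :: ('a::linorder, 'r::ring_1) mat set)"
proof
  interpret group "McLain :: ('a, 'r) mat monoid" by (rule group_McLain)
  have lt: "a < c" if "(a, c) \<in> \<Delta>" for a c
    using assms that unfolding closed_rel_def Phi_def by blast
  show "M_of \<Delta> \<subseteq> (supported \<Delta> :: ('a, 'r) mat set)"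
    unfolding M_of_def
    by (rule generate_subgroup_incl[OF _ subgroup_supported[OF assms]])
      (use root_elem_mem_supported lt in \<open>fastforce simp: root_subgroup_def\<close>)
  let ?S = "\<lambda>A :: ('a, 'r) mat. {(a, b). a \<noteq> b \<and> A a b \<noteq> 0}"
  have "A \<in> M_of \<Delta>" if "A \<in> supported \<Delta>" for A :: "('a, 'r) mat"
    using that
  proof (induction "card (?S A)" arbitrary: A rule: less_induct)
    case less
    have fin: "finite (?S A)" using less.prems unfolding supported_def mem_McLain_iff by blast
    have Ac: "A \<in> carrier McLain" using less.prems unfolding supported_def by blast
    show ?case
    proof (cases "?S A = {}")
      case True
      have "A a b = mone a b" for a b using True McLain_diag[OF Ac] by (auto simp: mone_def)
      then have "A = \<one>\<^bsub>McLain\<^esub>" by (auto simp: fun_eq_iff)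
      then show ?thesis unfolding M_of_def by (metis generate.one)
    next
      case False
      \<comment> \<open>If the column \<open>c\<close> is maximal, row \<open>c\<close> of \<open>A\<close> is trivial, so \<open>1 + A\<^sub>a\<^sub>c e\<^sub>a\<^sub>c\<close> splits off on the left.\<close>
      have "Max (snd ` ?S A) \<in> snd ` ?S A" using fin False by (intro Max_in) auto
      then obtain a where ac: "(a, Max (snd ` ?S A)) \<in> ?S A" by auto
      define c where "c = Max (snd ` ?S A)"
      have ac: "a \<noteq> c" "A a c \<noteq> 0" using ac unfolding c_def by auto
      have row: "A c d = 0" if "d \<noteq> c" for d
      proof (rule ccontr)
        assume nz: "A c d \<noteq> 0"
        then have "d \<in> snd ` ?S A" using that by force
        then have "d \<le> c" using fin unfolding c_def by simp
        then show False using McLain_upper[OF Ac nz] that by simp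
      qed
      define B where "B = (\<lambda>u v. if u = a \<and> v = c then 0 else A u v)"
      define E where "E = madd mone (unit_mat (A a c) a c)"
      have SB: "?S B = ?S A - {(a, c)}" unfolding B_def by auto
      have "B \<in> supported \<Delta>" using less.prems ac fin SB
        unfolding supported_def mem_McLain_iff by (auto simp: B_def)
      moreover have "card (?S B) < card (?S A)"
        unfolding SB using fin ac by (intro card_Diff1_less) auto
      ultimately have B: "B \<in> M_of \<Delta>" using less.hyps by blast
      have "E \<in> root_subgroup a c" unfolding E_def root_subgroup_def by blast
      moreover have "(a, c) \<in> \<Delta>" using less.prems ac unfolding supported_def by blast
      ultimately have E: "E \<in> M_of \<Delta>" unfolding M_of_def by (auto intro: generate.incl)
      have "A = mmult E B"
      proof (intro ext)
        fix u v
        \<comment> \<open>Row \<open>u\<close> of \<open>E\<close> vanishes outside the columns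
          \<open>u\<close> and \<open>c\<close>.\<close>
        have "mmult E B u v = (\<Sum>b\<in>{u, c}. E u b * B b v)"
          unfolding mmult_def
          by (rule Sum_any.expand_superset)
            (auto simp: E_def madd_def mone_def unit_mat_def split: if_splits)
        also have "\<dots> = A u v"
          using ac row[of v] McLain_diag[OF Ac]
          by (cases "u = c"; cases "u = a"; cases "v = c")
            (auto simp: E_def B_def madd_def mone_def unit_mat_def)
        finally show "A u v = mmult E B u v" ..
      qed
      then show ?thesis
        using generate.eng E B unfolding M_of_def by fastforce
    qed
  qed
  then show "(supported \<Delta> :: ('a, 'r) mat set) \<subseteq> M_of \<Delta>" by blast
qed

section \<open>Adjoining a single position\<close>

lemma supported_insert_step:
  fixes \<Delta> :: "('a::linorder \<times> 'a) set"
  assumes cl: "closed_rel \<Delta>" "closed_rel (insert (a, c) \<Delta>)" and ac: "(a, c) \<notin> \<Delta>"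
  defines "G \<equiv> (McLain :: ('a, 'r::ring_1) mat monoid)\<lparr>carrier := supported (insert (a, c) \<Delta>)\<rparr>"
  shows "supported \<Delta> \<lhd> G" "card (rcosets\<^bsub>G\<^esub> (supported \<Delta>)) = card (UNIV :: 'r set)"
    "finite (UNIV :: 'r set) \<Longrightarrow> finite (rcosets\<^bsub>G\<^esub> (supported \<Delta>))"
proof -
  let ?\<Delta>' = "insert (a, c) \<Delta>"
  let ?h = "\<lambda>A :: ('a, 'r) mat. A a c"
  interpret M: group "McLain :: ('a, 'r) mat monoid" by (rule group_McLain)
  have lt: "a < c" using cl(2) unfolding closed_rel_def Phi_def by auto
  have car: "A \<in> carrier McLain" if "A \<in> supported ?\<Delta>'" for A :: "('a, 'r) mat"
    using that unfolding supported_def by blast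
  have gG: "group G" unfolding G_def by (rule M.subgroup_imp_group[OF subgroup_supported[OF cl(2)]])
  have "?h \<in> hom G additive_group"
  proof (rule homI)
    fix A B assume "A \<in> carrier G" "B \<in> carrier G"
    then have AB: "A \<in> supported ?\<Delta>'" "B \<in> supported ?\<Delta>'" unfolding G_def by auto
    \<comment> \<open>Neither \<open>(a, b)\<close> nor \<open>(b, c)\<close> is the new position,
      so both would lie in \<open>\<Delta>\<close>, and closedness of \<open>\<Delta>\<close> would
      give \<open>(a, c) \<in> \<Delta>\<close>.\<close>
    have "A a b * B b c = 0" if b: "b \<noteq> a" "b \<noteq> c" for b
    proof (rule ccontr)
      assume "A a b * B b c \<noteq> 0"
      then have "A a b \<noteq> 0" "B b c \<noteq> 0" by auto
      then have "(a, b) \<in> \<Delta>" "(b, c) \<in> \<Delta>" using AB[THEN supportedD] b by auto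
      then show False using cl(1) ac unfolding closed_rel_def by blast
    qed
    then have "mmult A B a c = A a c + B a c"
      using mmult_eq_two[of a c A B] lt AB car McLain_diag[of A a] McLain_diag[of B c]
      by (simp add: add.commute)
    then show "?h (A \<otimes>\<^bsub>G\<^esub> B) = ?h A \<otimes>\<^bsub>additive_group\<^esub> ?h B"
      unfolding G_def by (simp add: additive_group_def)
  qed (simp add: additive_group_def)
  then interpret h: group_hom G additive_group ?h
    using gG group_additive_group by (simp add: group_hom_def group_hom_axioms_def)
  have ker: "kernel G additive_group ?h = supported \<Delta>"
    using lt ac unfolding kernel_def G_def supported_def additive_group_def by force
  show "supported \<Delta> \<lhd> G" using h.normal_kernel unfolding ker .
  have "madd mone (unit_mat r a c) \<in> carrier G" for r
    using root_elem_mem_supported[of a c ?\<Delta>' r] lt unfolding G_def by simp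
  moreover have "?h (madd mone (unit_mat r a c)) = r" for r :: 'r
    using lt by (auto simp: madd_def mone_def unit_mat_def)
  ultimately have "r \<in> ?h ` carrier G" for r by (metis (no_types, lifting) image_eqI)
  then have "?h ` carrier G = carrier additive_group" by (auto simp: additive_group_def)
  \<comment> \<open>The first isomorphism theorem is used only as a bijection between the cosets and
    \<open>R\<close>.\<close>
  from h.FactGroup_iso_set[OF this]
  have bij: "bij_betw (\<lambda>X. the_elem (?h ` X)) (rcosets\<^bsub>G\<^esub> (supported \<Delta>)) (UNIV :: 'r set)"
    unfolding ker iso_def by (simp add: FactGroup_def additive_group_def)
  show "card (rcosets\<^bsub>G\<^esub> (supported \<Delta>)) = card (UNIV :: 'r set)"
    by (rule bij_betw_same_card[OF bij])
  show "finite (UNIV :: 'r set) \<Longrightarrow> finite (rcosets\<^bsub>G\<^esub> (supported \<Delta>))"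
    using bij_betw_finite[OF bij] by blast
qed

section \<open>Adjoining the missing positions\<close>

definition row_before :: "'a::linorder \<times> 'a \<Rightarrow> 'a \<times> 'a \<Rightarrow> bool" where
  "row_before x y \<longleftrightarrow> fst x < fst y \<or> fst x = fst y \<and> snd x > snd y"

text \<open>The position \<open>x\<close> itself is left out, so it first appears at the next index;
  thus the least index gives \<open>Gamma1 D\<close> and limit indices give unions.\<close>

definition stage :: "('a::linorder \<times> 'a) set \<Rightarrow> 'a \<times> 'a \<Rightarrow> ('a \<times> 'a) set" where
  "stage D x = Gamma1 D \<union> {y \<in> Phi. row_before y x}"

lemma row_before_trans: "row_before x y \<Longrightarrow> row_before y z \<Longrightarrow> row_before x z"
  unfolding row_before_def by auto

lemma row_before_irrefl: "\<not> row_before x x"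
  unfolding row_before_def by auto

lemma row_before_total: "x \<noteq> y \<Longrightarrow> row_before x y \<or> row_before y x"
  unfolding row_before_def by (auto simp: prod_eq_iff)

lemma Gamma1_subset_Phi: "Gamma1 D \<subseteq> Phi"
  unfolding Gamma1_def Gamma_def Omega_def by blast

text \<open>Let \<open>u < v < w\<close>. The position \<open>(u, w)\<close> precedes
  \<open>(u, v)\<close>, being further right in the same row, and precedes \<open>(v, w)\<close>,
  being in an earlier row. So if either factor precedes \<open>x\<close>, so does
  \<open>(u, w)\<close>; otherwise \<open>Gamma1 D\<close> is closed already.\<close>

lemma closed_stage:
  assumes "basic_subset D"
  shows "closed_rel (stage D x)"
proof -
  obtain a c where x: "x = (a, c)" by fastforce
  have G: "(u, w) \<in> Gamma1 D" if "(u, v) \<in> Gamma1 D" "(v, w) \<in> Gamma1 D" for u v w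
    using closed_Gamma1[OF assms] that unfolding closed_rel_def by blast
  have "(u, w) \<in> stage D x" if uv: "(u, v) \<in> stage D x" and vw: "(v, w) \<in> stage D x" for u v w
  proof -
    have lt: "u < v" "v < w"
      using uv vw Gamma1_subset_Phi[of D] unfolding stage_def Phi_def by auto
    show ?thesis
      using uv vw lt G[of u v w] unfolding stage_def x row_before_def Phi_def by auto
  qed
  then show ?thesis using Gamma1_subset_Phi[of D] unfolding closed_rel_def stage_def by blast
qed

text \<open>A lexicographic product: the finitely many rows are well-founded under \<open><\<close>,
  the columns under the reverse order.\<close>

lemma wf_row_before:
  fixes A B :: "'a::linorder set"
  assumes "finite A" "wf {(y, z). y \<in> B \<and> z \<in> B \<and> z < y}"
  shows "wf {(x, y). x \<in> A \<times> B \<and> y \<in> A \<times> B \<and> row_before x y}"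
proof -
  let ?r = "{(x, y). x \<in> A \<and> y \<in> A \<and> x < y}"
  have "finite ?r" using assms(1) by (intro finite_subset[of ?r "A \<times> A"]) auto
  moreover have "acyclic ?r"
  proof -
    have "trans ?r" by (auto simp: trans_def)
    then show ?thesis unfolding acyclic_def by (simp add: trancl_id)
  qed
  ultimately have "wf ?r" by (rule finite_acyclic_wf)
  then have "wf (?r <*lex*> {(y, z). y \<in> B \<and> z \<in> B \<and> z < y})" using assms(2) by blast
  then show ?thesis by (rule wf_subset) (auto simp: row_before_def)
qed

theorem theorem8p7:
  fixes D :: "('a::linorder \<times> 'a) set"
  assumes "\<exists>\<chi> :: 'r::ring_1 \<Rightarrow> 'f::field. right_primitive \<chi>"
    and "basic_subset D"
    and "\<alpha> = Min (fst ` D)" and "\<beta> = Max (snd ` D)"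
    and "well_order_on {\<alpha>..\<beta>} {(x, y). x \<in> {\<alpha>..\<beta>} \<and> y \<in> {\<alpha>..\<beta>} \<and> x \<ge> y}"
    and "finite (UNIV :: 'r set)"
  shows "strongly_ascendant CHAR('f) (I_of D) (McLain :: ('a, 'r) mat monoid)"
proof -
  have D: "finite D" "D \<noteq> {}" "D \<subseteq> Phi" using assms(2) unfolding basic_subset_def by auto
  have bd: "\<alpha> \<le> a" "a < b" "b \<le> \<beta>" if "(a, b) \<in> D" for a b
  proof -
    have "a \<in> fst ` D" "b \<in> snd ` D" using that by force+
    then show "\<alpha> \<le> a" "b \<le> \<beta>" using D(1) assms(3,4) by auto
    show "a < b" using that D(3) unfolding Phi_def by blast
  qed
  have \<alpha>\<beta>: "\<alpha> \<le> \<beta>" using bd D(2) by fastforce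
  define N where "N = Phi - Gamma1 D"
  \<comment> \<open>\<open>(\<beta>, \<beta>) \<notin> \<Phi>\<close> serves as an additional last index.\<close>
  define t where "t = (\<beta>, \<beta>)"
  define X where "X = insert t N"
  define r where "r = {(x, y). x \<in> X \<and> y \<in> X \<and> (x = y \<or> row_before x y)}"
  define f :: "'a \<times> 'a \<Rightarrow> ('a, 'r) mat set" where "f x = supported (stage D x)" for x
  \<comment> \<open>A missing position lies in the row of some \<open>(a, b) \<in> D\<close>, to the
    left of \<open>b\<close>. Hence finitely many rows, columns within the interval, and
    \<open>a < \<beta>\<close>, which places it before \<open>t\<close>.\<close>
  have N: "a \<in> fst ` D" "\<alpha> \<le> a" "a < c" "c \<le> \<beta>" "a < \<beta>" if "(a, c) \<in> N" for a c
  proof -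
    have "\<exists>b. (a, b) \<in> D \<and> a < c \<and> c < b"
      using that unfolding N_def Gamma1_def Gamma_def Phi_def by auto
    then obtain b where "(a, b) \<in> D" "a < c" "c < b" by blast
    moreover from this have "\<alpha> \<le> a" "b \<le> \<beta>" using bd by auto
    ultimately show "a \<in> fst ` D" "\<alpha> \<le> a" "a < c" "c \<le> \<beta>" "a < \<beta>" by force+
  qed
  have Nt: "row_before x t" if "x \<in> N" for x
    using N(5)[of "fst x" "snd x"] that unfolding row_before_def t_def by simp
  have Field: "Field r = X" unfolding r_def Field_def by auto
  \<comment> \<open>The extra row \<open>\<beta>\<close> accommodates \<open>t\<close>.\<close>
  have X: "X \<subseteq> insert \<beta> (fst ` D) \<times> {\<alpha>..\<beta>}"
  proof
    fix x assume "x \<in> X"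
    then show "x \<in> insert \<beta> (fst ` D) \<times> {\<alpha>..\<beta>}"
      using N[of "fst x" "snd x"] \<alpha>\<beta> unfolding X_def t_def by (cases x) auto
  qed
  have "wf {(y, z). y \<in> {\<alpha>..\<beta>} \<and> z \<in> {\<alpha>..\<beta>} \<and> z < y}"
    using assms(5) unfolding well_order_on_def
    by (elim conjE) (erule wf_subset, auto)
  with wf_row_before[of "insert \<beta> (fst ` D)" "{\<alpha>..\<beta>}"] D(1)
  have "wf {(x, y). x \<in> insert \<beta> (fst ` D) \<times> {\<alpha>..\<beta>} \<and> y \<in> insert \<beta> (fst ` D) \<times> {\<alpha>..\<beta>} \<and> row_before x y}"
    by simp
  then have wf: "wf (r - Id)" by (rule wf_subset) (use X in \<open>auto simp: r_def\<close>)
  have wo: "Well_order r"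
    unfolding order_on_defs Field
  proof (intro conjI)
    show "refl_on X r" by (auto simp: r_def refl_on_def)
    show "r \<subseteq> X \<times> X" by (auto simp: r_def)
    show "trans r" unfolding trans_def r_def using row_before_trans by blast
    show "antisym r"
      unfolding antisym_def r_def using row_before_trans row_before_irrefl by blast
    show "total_on X r" unfolding total_on_def r_def using row_before_total by blast
  qed (rule wf)
  have "t \<in> X" unfolding X_def by simp
  then obtain x0 where x0: "x0 \<in> X" "\<And>y. (y, x0) \<in> r - Id \<Longrightarrow> y \<notin> X"
    by (rule wfE_min[OF wf]) (rule that)
  have x0': "(x0, x) \<in> r" if "x \<in> X" for x
    using x0(1) x0(2)[of x] that row_before_total[of x x0] unfolding r_def by blast
  have stage0: "stage D x0 = Gamma1 D"
  proof -
    have "y \<in> Gamma1 D" if "y \<in> Phi" "row_before y x0" for y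
      using x0(1) x0(2)[of y] that row_before_irrefl unfolding r_def X_def N_def by blast
    then show ?thesis unfolding stage_def by blast
  qed
  have stage1: "stage D t = Phi"
  proof -
    have "y \<in> stage D t" if "y \<in> Phi" for y
      using that Nt[of y] unfolding stage_def N_def by blast
    then show ?thesis using Gamma1_subset_Phi[of D] unfolding stage_def by blast
  qed
  have step: "f x \<lhd> McLain\<lparr>carrier := f x'\<rparr> \<and>
      finite (rcosets\<^bsub>McLain\<lparr>carrier := f x'\<rparr>\<^esub> (f x)) \<and>
      \<not> CHAR('f) dvd card (rcosets\<^bsub>McLain\<lparr>carrier := f x'\<rparr>\<^esub> (f x))" if s: "successor r x x'" for x x'
  proof -
    have xx': "x \<in> X" "x' \<in> X" "row_before x x'"
      using s unfolding successor_def r_def by auto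
    have "x \<noteq> t" using xx' Nt row_before_trans row_before_irrefl unfolding X_def by blast
    then have xN: "x \<in> N" using xx' unfolding X_def by blast
    \<comment> \<open>No missing position lies strictly between \<open>x\<close> and its successor,
      so exactly \<open>x\<close> is gained.\<close>
    have "y \<in> insert x (stage D x)" if "y \<in> stage D x'" for y
    proof (cases "y \<in> Gamma1 D")
      case False
      then have y: "y \<in> N" "row_before y x'" using that unfolding stage_def N_def by auto
      have "\<not> row_before x y"
        using s y xx' row_before_irrefl unfolding successor_def r_def X_def by blast
      then show ?thesis using row_before_total[of x y] y unfolding stage_def N_def by auto
    qed (simp add: stage_def)
    moreover have "insert x (stage D x) \<subseteq> stage D x'"
      using xN xx'(3) row_before_trans unfolding stage_def N_def by blast
    ultimately have eq: "stage D x' = insert x (stage D x)" by blast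
    have notin: "x \<notin> stage D x" using xN row_before_irrefl unfolding stage_def N_def by blast
    obtain a c where x: "x = (a, c)" by fastforce
    note st = supported_insert_step[where ?'r = 'r, of "stage D x" a c, folded x,
        OF closed_stage[OF assms(2)] closed_stage[OF assms(2), of x', unfolded eq] notin,
        folded eq, folded f_def]
    show ?thesis
      using st assms(1,6) right_primitive_CHAR_not_dvd_card by fastforce
  qed
  have lim: "f x = (\<Union>y\<in>{y. (y, x) \<in> r \<and> y \<noteq> x}. f y)"
    if x: "x \<in> X" "x \<noteq> x0" "\<nexists>y. successor r y x" for x
  proof
    have "stage D y \<subseteq> stage D x" if "row_before y x" for y
      using that row_before_trans unfolding stage_def by blast
    then show "(\<Union>y\<in>{y. (y, x) \<in> r \<and> y \<noteq> x}. f y) \<subseteq> f x"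
      unfolding f_def r_def using supported_mono by blast
    show "f x \<subseteq> (\<Union>y\<in>{y. (y, x) \<in> r \<and> y \<noteq> x}. f y)"
    proof
      fix A assume A: "A \<in> f x"
      \<comment> \<open>\<open>A\<close> has finite support, so it occurs just after the last missing position it involves.\<close>
      define S where "S = {(a, b). a \<noteq> b \<and> A a b \<noteq> 0} \<inter> N"
      have Ac: "A \<in> carrier McLain" using A unfolding f_def supported_def by blast
      have "finite S" using Ac unfolding S_def mem_McLain_iff by blast
      have Sx: "S \<subseteq> {y\<in>N. row_before y x}"
        using A unfolding S_def f_def supported_def stage_def N_def by auto
      \<comment> \<open>Finitely many positions below a limit index have a strict upper bound below
        it. Adding \<open>s\<close>: since \<open>x\<close> does not succeed \<open>s\<close>, some
        \<open>w\<close> lies strictly between, and the later of \<open>z\<close> and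
        \<open>w\<close> works. Strictness matters because \<open>stage D z\<close> need not contain
        \<open>z\<close>.\<close>
      have "\<exists>z\<in>X. row_before z x \<and> (\<forall>s\<in>T. row_before s z)"
        if "finite T" "T \<subseteq> {y\<in>N. row_before y x}" for T
        using that
      proof (induction T)
        case empty
        show ?case using x0(1) x0'[OF x(1)] x(2) unfolding r_def by blast
      next
        case (insert s T)
        then obtain z where z: "z \<in> X" "row_before z x" "\<forall>s\<in>T. row_before s z"
          by blast
        have s: "s \<in> X" "row_before s x" using insert.prems unfolding X_def by auto
        then have "\<not> successor r s x" using x(3) by blast
        then obtain w where w: "w \<in> X" "row_before s w" "row_before w x"
          using s x(1) row_before_irrefl unfolding successor_def r_def by blast
        consider "z = w" | "row_before z w" | "row_before w z" using row_before_total by blast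
        then show ?case
        proof cases
          case 3
          then show ?thesis using z w row_before_trans by blast
        qed (use z w row_before_trans in blast)+
      qed
      from this[OF \<open>finite S\<close> Sx] obtain z
        where z: "z \<in> X" "row_before z x" "\<forall>s\<in>S. row_before s z" by blast
      have "(a, b) \<in> stage D z" if "a \<noteq> b" "A a b \<noteq> 0" for a b
      proof -
        have "a < b" using McLain_upper[OF Ac] that by fastforce
        then show ?thesis using z(3) that unfolding stage_def S_def N_def Phi_def by auto
      qed
      then have "A \<in> f z" using Ac unfolding f_def supported_def by blast
      moreover have "(z, x) \<in> r" "z \<noteq> x" using z x(1) row_before_irrefl unfolding r_def by blast+
      ultimately show "A \<in> (\<Union>y\<in>{y. (y, x) \<in> r \<and> y \<noteq> x}. f y)" by blast
    qed
  qed
  have "strongly_ascending_series CHAR('f) (McLain :: ('a, 'r) mat monoid) (I_of D) r f"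
    unfolding strongly_ascending_series_def Field
  proof (rule conjI, rule wo[unfolded Field], rule bexI[of _ x0], rule bexI[of _ t], intro conjI)
    show "\<forall>x\<in>X. (x0, x) \<in> r \<and> (x, t) \<in> r" using x0' Nt unfolding r_def X_def by auto
    show "f x0 = I_of D"
      unfolding f_def stage0 I_of_def M_of_eq_supported[OF closed_Gamma1[OF assms(2)]] ..
    show "f t = carrier McLain" unfolding f_def stage1 by (rule supported_Phi)
    show "\<forall>x\<in>X. subgroup (f x) McLain"
      unfolding f_def using subgroup_supported[OF closed_stage[OF assms(2)]] by blast
    show "\<forall>x x'. successor r x x' \<longrightarrow>
         f x \<lhd> McLain\<lparr>carrier := f x'\<rparr> \<and>
         finite (rcosets\<^bsub>McLain\<lparr>carrier := f x'\<rparr>\<^esub> (f x)) \<and>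
         \<not> CHAR('f) dvd card (rcosets\<^bsub>McLain\<lparr>carrier := f x'\<rparr>\<^esub> (f x))"
      using step by blast
    show "\<forall>x\<in>X. x \<noteq> x0 \<and> (\<nexists>y. successor r y x) \<longrightarrow>
       f x = (\<Union>y\<in>{y. (y, x) \<in> r \<and> y \<noteq> x}. f y)"
      using lim by blast
  qed (use x0 in \<open>auto simp: X_def\<close>)
  then show ?thesis by (rule strongly_ascendantI)
qed

end
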